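(* Let $1<q<p$, $q<N$, $s\ge 0$, $0\le m\le q-1$ and $$s(N-q)+m(N-1)<N(q-1).$$ Then any positive solution of $$-\Delta_p u-\Delta_q u\ge u^s|\nabla u|^m\quad\text{in }\mathbb R^N$$ is a constant.
   Context: For $r>1$, $\Delta_r u=\operatorname{div}(|\nabla u|^{r-2}\nabla u)$. A positive solution of $-\Delta_p u-\Delta_q u\ge u^s|\nabla u|^m$ in $\mathbb R^N$ is a function $u\in C^1(\mathbb R^N)$, $u>0$, such that $$\int_{\mathbb R^N} |\nabla u|^{p-2}\nabla u\cdot\nabla\varphi\,dx+\int_{\mathbb R^N} |\nabla u|^{q-2}\nabla u\cdot\nabla\varphi\,dx\ge \int_{\mathbb R^N} u^s|\nabla u|^m\varphi\,dx\quad\text{for all }\varphi\in C^1_c(\mathbb R^N),\ \varphi\ge 0.$$ When $m=0$ the factor $|\nabla u|^m$ is identically $1$. *)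

theory Defs
  imports "HOL-Analysis.Analysis"
begin

definition grad :: "(real ^ 'n \<Rightarrow> real) \<Rightarrow> real ^ 'n \<Rightarrow> real ^ 'n" where
  "grad u x = (\<chi> i. frechet_derivative u (at x) (axis i 1))"

definition C1 :: "(real ^ 'n \<Rightarrow> real) \<Rightarrow> bool" where
  "C1 u \<longleftrightarrow> (\<forall>x. u differentiable (at x)) \<and> continuous_on UNIV (grad u)"

definition C1_compact_support :: "(real ^ 'n \<Rightarrow> real) \<Rightarrow> bool" where
  "C1_compact_support \<phi> \<longleftrightarrow> C1 \<phi> \<and> compact (closure {x. \<phi> x \<noteq> 0})"

text \<open>The field \<open>|\<xi>|\<^sup>r\<^sup>-\<^sup>2 \<xi>\<close> at \<open>\<xi> = \<nabla>u\<close>. Since \<open>0 powr a = 0\<close> (and \<open>\<xi> = 0\<close> there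
  anyway), it vanishes at \<open>\<xi> = 0\<close>, which for \<open>r > 1\<close> is its continuous extension.\<close>

definition flux :: "real \<Rightarrow> real ^ 'n \<Rightarrow> real ^ 'n" where
  "flux r \<xi> = norm \<xi> powr (r - 2) *\<^sub>R \<xi>"

text \<open>In the library \<open>0 powr 0 = 0\<close>, but \<open>|\<nabla>u|\<^sup>m\<close> is identically \<open>1\<close> for \<open>m = 0\<close>, also at
  critical points of \<open>u\<close>.\<close>

definition norm_pow :: "real ^ 'n \<Rightarrow> real \<Rightarrow> real" where
  "norm_pow \<xi> m = (if m = 0 then 1 else norm \<xi> powr m)"

text \<open>All integrands below are continuous with compact support when \<open>p, q > 1\<close> and \<open>m \<ge> 0\<close>, so the
  integrals are never subject to the convention that non-integrable functions have integral \<open>0\<close>.\<close>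

definition positive_solution ::
  "real \<Rightarrow> real \<Rightarrow> real \<Rightarrow> real \<Rightarrow> (real ^ 'n \<Rightarrow> real) \<Rightarrow> bool" where
  "positive_solution p q s m u \<longleftrightarrow>
     C1 u \<and> (\<forall>x. u x > 0) \<and>
     (\<forall>\<phi>. C1_compact_support \<phi> \<longrightarrow> (\<forall>x. \<phi> x \<ge> 0) \<longrightarrow>
        (LINT x|lborel. flux p (grad u x) \<bullet> grad \<phi> x)
        + (LINT x|lborel. flux q (grad u x) \<bullet> grad \<phi> x)
        \<ge> (LINT x|lborel. u x powr s * norm_pow (grad u x) m * \<phi> x))"

end

theory Submission
  imports Defs
begin

text \<open>
  Suppose \<open>\<nabla>u(x\<^sub>0) \<noteq> 0\<close>, put \<open>K = u(x\<^sub>0) + 1\<close> and test the inequality with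
  \<open>\<psi> = h(u) \<Phi>\<close>, where \<open>h(y) = (max(0, y^(-\<alpha>/2) - K^(-\<alpha>/2)))\<^sup>2\<close> is a nonincreasing function that
  vanishes for \<open>y \<ge> K\<close> and \<open>\<Phi> = \<rho>^k\<close>, \<open>\<rho> = max(0, 1 - |x|\<^sup>2/R\<^sup>2)\<close>, is a cutoff at scale \<open>R\<close>.
  With \<open>t = |\<nabla>u|\<close> and \<open>H = -h'\<close>, the inequality implies that the integral of
  \<open>(t^p + t^q) H(u) \<Phi> + u^s t^m h(u) \<Phi>\<close> is at most that of
  \<open>(t^(p-1) + t^(q-1)) h(u) |\<nabla>\<Phi>|\<close>, and \<open>|\<nabla>\<Phi>| \<le> (2k/R) \<rho>^(k-1)\<close>.

  The right-hand side is absorbed pointwise. Either \<open>t \<rho> \<ge> 1\<close>, and then \<open>t^(p-1) \<rho>^(k-1) \<le> t^p \<Phi>\<close>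
  with the small factor \<open>1/R\<close> in front; since \<open>h \<le> (K/\<alpha>) H\<close>, the \<open>p\<close>-energy on the left controls
  it. Or \<open>t \<rho> < 1\<close>, and then \<open>t^(p-1)\<close> is dominated by \<open>t^(q-1)\<close> at the cost of a few powers of \<open>\<rho>\<close>
  (\<open>higher_power_absorption\<close>). So only the \<open>q\<close>-Laplacian matters. Because \<open>m \<le> q - 1 < q\<close>, the
  power \<open>t^(q-1)\<close> can be interpolated as
  \<open>t^(q-1) = (t^q / u)^a (u^s t^m)^b (u^\<alpha>)^c\<close> with \<open>a + b + c = 1\<close>.
  The first two factors belong to the left-hand side, as \<open>H \<ge> \<alpha> h/u\<close>, and the third one is
  harmless, as \<open>u^\<alpha> h(u) \<le> 1\<close>. What remains is a multiple of \<open>R^(-1/c)\<close>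
  (\<open>gradient_term_interpolation\<close>, \<open>test_fun_pointwise\<close>), whose integral over the ball of radius \<open>R\<close>
  is of order \<open>R^(N-1/c)\<close>.

  The hypothesis on \<open>s\<close> and \<open>m\<close> is exactly what allows \<open>\<alpha> > 0\<close> together with \<open>c < 1/N\<close>
  (\<open>exponent_choice\<close>). As \<open>R \<rightarrow> \<infinity>\<close>, the integral of \<open>t^q H(u)\<close> over a small ball around \<open>x\<^sub>0\<close> would
  be \<open>0\<close>, although the integrand is positive at \<open>x\<^sub>0\<close>. Hence \<open>\<nabla>u = 0\<close> everywhere.
\<close>

section \<open>Scalar inequalities\<close>

text \<open>For given \<open>c\<close> the two conditions \<open>a + b + c = 1\<close> and \<open>q a + m b = q - 1\<close> determine \<open>a\<close> and \<open>b\<close>,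
  and \<open>\<alpha> > 0\<close> becomes a linear condition on \<open>c\<close>. At \<open>c = 1/N\<close> it is the subcriticality
  assumption, so it survives for \<open>c\<close> slightly smaller.\<close>

lemma exponent_choice:
  fixes N q s m :: real
  assumes "1 < q" "q < N" "0 \<le> s" "0 \<le> m" "m \<le> q - 1"
    and sub: "s * (N - q) + m * (N - 1) < N * (q - 1)"
  obtains a b c \<alpha> where "0 < a" "0 < b" "0 < c" "c * N < 1" "a + b + c = 1"
    "q * a + m * b = q - 1" "a = b * s + \<alpha> * c" "0 < \<alpha>"
proof -
  \<comment> \<open>this is \<open>(q - m) (a - b s)\<close> for the \<open>a\<close> and \<open>b\<close> belonging to \<open>c\<close>\<close>
  let ?g = "\<lambda>c. q - 1 - m + m * c - s * (1 - c * q)"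
  have "?g (1 / N) = (N * (q - 1) - (s * (N - q) + m * (N - 1))) / N"
    using assms by (simp add: field_simps)
  also have "\<dots> > 0"
    using assms by simp
  finally have g0: "?g (1 / N) > 0" .
  have "isCont ?g (1 / N)"
    by (intro continuous_intros)
  then have "\<forall>\<^sub>F c in at_left (1 / N). ?g c > 0"
    using g0 by (intro order_tendstoD(1)[of ?g "?g (1 / N)"])
      (auto simp: isCont_def intro: filterlim_mono at_le)
  moreover have "\<forall>\<^sub>F c in at_left (1 / N). c \<in> {0<..<1 / N}"
    using assms by (intro eventually_at_left_real) auto
  ultimately have "\<forall>\<^sub>F c in at_left (1 / N). ?g c > 0 \<and> c \<in> {0<..<1 / N}"
    by (rule eventually_conj)
  then obtain c where c: "?g c > 0" "0 < c" "c < 1 / N"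
    by (metis (no_types, lifting) eventually_happens' greaterThanLessThan_iff
        trivial_limit_at_left_real)
  have cN: "c * N < 1"
    using c assms by (simp add: field_simps)
  have cq: "c * q < 1"
    using cN c assms by (smt (verit) mult_strict_left_mono)
  have qm: "q - m > 0"
    using assms by auto
  define a where "a = (q - 1 - m + m * c) / (q - m)"
  define b where "b = (1 - c * q) / (q - m)"
  have ab: "(q - m) * a = q - 1 - m + m * c" "(q - m) * b = 1 - c * q"
    using qm by (auto simp: a_def b_def)
  have b: "b > 0"
    using qm cq by (auto simp: b_def)
  have "(q - m) * (a - b * s) = (q - m) * a - s * ((q - m) * b)"
    by (simp add: algebra_simps)
  also have "\<dots> = ?g c"
    by (simp only: ab)
  finally have "(q - m) * (a - b * s) = ?g c" .
  then have abs: "a - b * s > 0"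
    using c qm by (metis zero_less_mult_pos)
  have "(q - m) * (a + b + c) = (q - m) * 1"
    using ab by (simp add: algebra_simps)
  then have s1: "a + b + c = 1"
    using qm by auto
  have "(q - m) * (q * a + m * b) = (q - m) * (q - 1)"
    using ab by algebra
  then have s2: "q * a + m * b = q - 1"
    using qm by auto
  show thesis
  proof (rule that[of a b c "(a - b * s) / c"])
    show "0 < a"
      using abs b assms by (smt (verit) mult_nonneg_nonneg)
  qed (use b c cN s1 s2 abs in auto)
qed

text \<open>A crude form of the weighted inequality between arithmetic and geometric means: each factor
  is at most the same power of \<open>X + Y + Z\<close>.\<close>

lemma weighted_product_le_sum:
  fixes X Y Z :: real
  assumes "0 < X" "0 < Y" "0 < Z" "0 \<le> a" "0 \<le> b" "0 \<le> c" "a + b + c = 1"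
  shows "X powr a * Y powr b * Z powr c \<le> X + Y + Z"
proof -
  let ?M = "X + Y + Z"
  have "X powr a * Y powr b * Z powr c \<le> ?M powr a * ?M powr b * ?M powr c"
    using assms by (intro mult_mono powr_mono2) auto
  also have "\<dots> = ?M"
    using assms by (simp flip: powr_add)
  finally show ?thesis .
qed

text \<open>The three conditions on the exponents make the powers of \<open>t\<close>, \<open>\<Phi>\<close> and \<open>y\<close> match in
  \<open>X^a Y^b Z^c\<close>, where \<open>X\<close>, \<open>Y\<close>, \<open>Z\<close> are the three terms of the bound. The assumption on \<open>T\<close> leaves
  its value at \<open>t = 0\<close> open, so that \<open>|\<nabla>u|^m\<close> qualifies for \<open>m = 0\<close> as well.\<close>

lemma gradient_term_interpolation:
  fixes t T y \<Phi> \<epsilon> l :: real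
  assumes "0 \<le> t" "0 < y" "0 \<le> \<Phi>" "0 < \<epsilon>" "0 < l" "1 < q"
    and T: "0 \<le> T" "0 < t \<Longrightarrow> T = t powr m"
    and abc: "0 < a" "0 < b" "0 < c" "a + b + c = 1" "q * a + m * b = q - 1" "a = b * s + \<alpha> * c"
  shows "l * (t powr (q - 1) * \<Phi> powr (1 - c))
    \<le> \<epsilon> * (t powr q * \<Phi> / y) + y powr s * T * \<Phi> + (\<epsilon> powr - a * l) powr (1 / c) * y powr \<alpha>"
proof (cases "t = 0 \<or> \<Phi> = 0")
  case True
  then have "l * (t powr (q - 1) * \<Phi> powr (1 - c)) = 0"
    by auto
  moreover have "0 \<le> \<epsilon> * (t powr q * \<Phi> / y) + y powr s * T * \<Phi>
      + (\<epsilon> powr - a * l) powr (1 / c) * y powr \<alpha>"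
    using assms by (intro add_nonneg_nonneg mult_nonneg_nonneg divide_nonneg_nonneg) auto
  ultimately show ?thesis
    by (simp only:)
next
  case False
  then have pos: "t > 0" "\<Phi> > 0" "y > 0" "\<epsilon> > 0" "l > 0"
    using assms by auto
  let ?X = "\<epsilon> * (t powr q * \<Phi> / y)" and ?Y = "y powr s * T * \<Phi>"
    and ?Z = "(\<epsilon> powr - a * l) powr (1 / c) * y powr \<alpha>"
  have e: "l * (t powr (q - 1) * \<Phi> powr (1 - c)) = ?X powr a * ?Y powr b * ?Z powr c"
  proof -
    have "?X powr a = \<epsilon> powr a * t powr (q * a) * \<Phi> powr a * y powr - a"
      using pos by (simp add: powr_mult powr_divide powr_powr powr_minus divide_simps)
    moreover have "?Y powr b = y powr (s * b) * t powr (m * b) * \<Phi> powr b"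
      using pos T by (simp add: powr_mult powr_powr)
    moreover have "?Z powr c = \<epsilon> powr - a * l * y powr (\<alpha> * c)"
      using pos abc by (simp add: powr_mult powr_powr)
    ultimately have "?X powr a * ?Y powr b * ?Z powr c =
        l * (\<epsilon> powr a * \<epsilon> powr - a) * (t powr (q * a) * t powr (m * b))
        * (\<Phi> powr a * \<Phi> powr b) * (y powr - a * y powr (s * b) * y powr (\<alpha> * c))"
      by (simp add: ac_simps)
    also have "\<dots> = l * (\<epsilon> powr (a + - a)) * t powr (q * a + m * b) * \<Phi> powr (a + b)
        * y powr (- a + s * b + \<alpha> * c)"
      by (simp only: powr_add)
    also have "\<dots> = l * (t powr (q - 1) * \<Phi> powr (1 - c))"
    proof -
      have "a + b = 1 - c" "- a + s * b + \<alpha> * c = 0"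
        using abc by (auto simp: algebra_simps)
      then show ?thesis
        unfolding abc(5) using pos by simp
    qed
    finally show ?thesis ..
  qed
  show ?thesis
    unfolding e
  proof (rule weighted_product_le_sum)
    show "0 < ?X"
      using pos by simp
    show "0 < ?Y"
      using pos T(2) by simp
    show "0 < ?Z"
      using pos by simp
  qed (use abc in linarith)+
qed

text \<open>The cutoff must enter the case distinction: where \<open>\<rho>\<close> is small, \<open>t \<ge> 1\<close> alone would not give
  \<open>t^(p-1) \<rho>^(k-1) \<le> t^p \<rho>^k\<close>. If \<open>t \<rho> < 1\<close>, trading \<open>t^(p-q)\<close> for \<open>\<rho>^(q-p)\<close> is affordable because \<open>k\<close> is
  large; this is where the lower bound on \<open>k\<close> comes from.\<close>

lemma higher_power_absorption:
  fixes t \<rho> p q c :: real and k :: nat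
  assumes "0 \<le> t" "0 \<le> \<rho>" "\<rho> \<le> 1" "1 < q" "q < p" "0 < c" "1 + p - q \<le> real k * c" "2 \<le> k"
  shows "(t powr (p - 1) + t powr (q - 1)) * \<rho> ^ (k - 1)
    \<le> t powr p * \<rho> ^ k + 2 * (t powr (q - 1) * (\<rho> ^ k) powr (1 - c))"
proof (cases "t = 0 \<or> \<rho> = 0")
  case True
  then have "(t powr (p - 1) + t powr (q - 1)) * \<rho> ^ (k - 1) = 0"
    using assms by auto
  moreover have "0 \<le> t powr p * \<rho> ^ k + 2 * (t powr (q - 1) * (\<rho> ^ k) powr (1 - c))"
    using assms by (intro add_nonneg_nonneg mult_nonneg_nonneg) auto
  ultimately show ?thesis
    by (simp only:)
next
  case False
  then have pos: "t > 0" "\<rho> > 0"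
    using assms by auto
  have le: "real k * (1 - c) \<le> real (k - 1) - (p - q)"
    using assms by (simp add: algebra_simps of_nat_diff)
  have \<rho>k: "\<rho> ^ k = \<rho> powr real k" "\<rho> ^ (k - 1) = \<rho> powr real (k - 1)"
    using pos by (simp_all only: powr_realpow)
  have \<Phi>: "(\<rho> powr real k) powr (1 - c) = \<rho> powr (real k * (1 - c))"
    by (simp add: powr_powr)
  have q: "t powr (q - 1) * \<rho> powr real (k - 1) \<le> t powr (q - 1) * \<rho> powr (real k * (1 - c))"
    using pos assms le by (intro mult_left_mono powr_mono') auto
  have p: "t powr (p - 1) * \<rho> powr real (k - 1)
    \<le> t powr p * \<rho> powr real k + t powr (q - 1) * \<rho> powr (real k * (1 - c))"
  proof (cases "t * \<rho> \<ge> 1")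
    case True
    have "t powr (p - 1) * \<rho> powr real (k - 1) * 1 \<le> t powr (p - 1) * \<rho> powr real (k - 1) * (t * \<rho>)"
      using True by (intro mult_left_mono) auto
    also have "\<dots> = (t powr (p - 1) * t powr 1) * (\<rho> powr real (k - 1) * \<rho> powr 1)"
      using pos by simp
    also have "\<dots> = t powr (p - 1 + 1) * \<rho> powr (real (k - 1) + 1)"
      by (simp only: powr_add)
    also have "\<dots> = t powr p * \<rho> powr real k"
      using assms by (simp add: of_nat_diff)
    finally show ?thesis
      by (smt (verit) mult_nonneg_nonneg powr_ge_zero)
  next
    case False
    have "(t powr (p - 1)) * \<rho> powr real (k - 1)
        = (t powr (q - 1 + (p - q))) * \<rho> powr (real (k - 1) - (p - q) + (p - q))"
      by simp
    also have "\<dots> = t powr (q - 1) * \<rho> powr (real (k - 1) - (p - q)) * (t * \<rho>) powr (p - q)"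
      unfolding powr_add using pos by (simp add: powr_mult)
    also have "\<dots> \<le> t powr (q - 1) * \<rho> powr (real k * (1 - c)) * 1"
      using pos assms False
      by (intro mult_mono powr_mono'[OF le] powr_le1 order_refl) auto
    finally show ?thesis
      by (smt (verit) mult_nonneg_nonneg powr_ge_zero)
  qed
  show ?thesis
    unfolding \<rho>k \<Phi> distrib_right using p q by linarith
qed

section \<open>Differentiable truncations\<close>

lemma DERIV_positive_part_power:
  fixes z :: real
  assumes "2 \<le> k"
  shows "((\<lambda>z. (max 0 z) ^ k) has_real_derivative real k * (max 0 z) ^ (k - 1)) (at z)"
proof -
  consider "z > 0" | "z < 0" | "z = 0"
    by linarith
  then show ?thesis
  proof cases
    case 1
    have "((\<lambda>z. z ^ k) has_real_derivative real k * z ^ (k - 1)) (at z)"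
      by (auto intro!: derivative_eq_intros)
    then have "((\<lambda>z. (max 0 z) ^ k) has_real_derivative real k * z ^ (k - 1)) (at z)"
      by (rule DERIV_cong_ev[THEN iffD1, rotated 3])
        (use 1 in \<open>auto intro!: eventually_mono[OF eventually_nhds_in_open[of "{0<..}"]]\<close>)
    then show ?thesis
      using 1 by simp
  next
    case 2
    have "((\<lambda>z. 0) has_real_derivative 0) (at z)"
      by simp
    then have "((\<lambda>z. (max 0 z) ^ k) has_real_derivative 0) (at z)"
      by (rule DERIV_cong_ev[THEN iffD1, rotated 3])
        (use 2 assms in \<open>auto intro!: eventually_mono[OF eventually_nhds_in_open[of "{..<0}"]]\<close>)
    then show ?thesis
      using 2 assms by (simp add: power_0_left)
  next
    case 3
    have "((\<lambda>h :: real. (max 0 h) ^ k / h) \<longlongrightarrow> 0) (at 0)"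
    proof (rule Lim_null_comparison)
      have "((\<lambda>h::real. \<bar>h\<bar> ^ (k - 1)) \<longlongrightarrow> \<bar>0\<bar> ^ (k - 1)) (at 0)"
        by (intro tendsto_intros)
      then show "((\<lambda>h::real. \<bar>h\<bar> ^ (k - 1)) \<longlongrightarrow> 0) (at 0)"
        using assms by (simp add: power_0_left)
      show "\<forall>\<^sub>F h::real in at 0. norm ((max 0 h) ^ k / h) \<le> \<bar>h\<bar> ^ (k - 1)"
      proof (intro always_eventually allI)
        fix h :: real
        obtain j where "k = Suc j"
          using assms by (cases k) auto
        then show "norm ((max 0 h) ^ k / h) \<le> \<bar>h\<bar> ^ (k - 1)"
          by (auto simp: max_def power_abs abs_mult power_0_left)
      qed
    qed
    then show ?thesis
      using 3 assms by (simp add: DERIV_def power_0_left)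
  qed
qed

text \<open>The weight \<open>h(y)\<close> of the test function, with \<open>a = \<alpha>/2\<close>. The negative power makes
  \<open>-h' \<ge> \<alpha> h/y\<close>, the truncation improves this to \<open>-h' \<ge> (\<alpha>/K) h\<close> with a constant factor, and the
  square makes \<open>h\<close> continuously differentiable at \<open>K\<close>.\<close>

definition trunc_pow :: "real \<Rightarrow> real \<Rightarrow> real \<Rightarrow> real" where
  "trunc_pow a K y = (max 0 (y powr - a - K powr - a))\<^sup>2"

text \<open>The sign is that of \<open>-h'\<close>, so that the function is nonnegative.\<close>

definition trunc_pow_slope :: "real \<Rightarrow> real \<Rightarrow> real \<Rightarrow> real" where
  "trunc_pow_slope a K y = 2 * a * max 0 (y powr - a - K powr - a) * y powr (- a - 1)"

lemma DERIV_trunc_pow: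
  assumes "0 < y"
  shows "(trunc_pow a K has_real_derivative - trunc_pow_slope a K y) (at y)"
proof -
  have "((\<lambda>y. y powr - a - K powr - a) has_real_derivative - a * y powr (- a - 1)) (at y)"
    using assms by (auto intro!: derivative_eq_intros)
  from DERIV_chain2[OF DERIV_positive_part_power[of 2] this] show ?thesis
    by (simp add: trunc_pow_def[abs_def] trunc_pow_slope_def algebra_simps)
qed

lemma trunc_pow_nonneg: "0 \<le> trunc_pow a K y"
  by (simp add: trunc_pow_def)

lemma trunc_pow_le:
  assumes "0 < y"
  shows "trunc_pow a K y * y powr (2 * a) \<le> 1"
proof -
  have "max 0 (y powr - a - K powr - a) \<le> y powr - a"
    by simp
  then have "trunc_pow a K y \<le> (y powr - a)\<^sup>2"
    unfolding trunc_pow_def by (intro power_mono) auto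
  also have "\<dots> = y powr (- (2 * a))"
    using assms by (simp add: powr_powr mult.commute flip: powr_numeral)
  finally have "trunc_pow a K y * y powr (2 * a) \<le> y powr (- (2 * a)) * y powr (2 * a)"
    by (rule mult_right_mono) simp
  then show ?thesis
    using assms by (simp flip: powr_add)
qed

lemma trunc_pow_slope_ge:
  assumes "0 < y" "0 < a"
  shows "2 * a * trunc_pow a K y / y \<le> trunc_pow_slope a K y"
proof -
  let ?w = "max 0 (y powr - a - K powr - a)"
  have "2 * a * trunc_pow a K y / y = 2 * a * ?w * (?w / y)"
    by (simp add: trunc_pow_def power2_eq_square)
  also have "\<dots> \<le> 2 * a * ?w * (y powr - a / y)"
    using assms by (intro mult_left_mono divide_right_mono) auto
  also have "\<dots> = trunc_pow_slope a K y"
    using assms by (simp add: trunc_pow_slope_def powr_diff)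
  finally show ?thesis .
qed

lemma trunc_pow_slope_nonneg: "0 \<le> a \<Longrightarrow> 0 \<le> trunc_pow_slope a K y"
  by (simp add: trunc_pow_slope_def)

lemma trunc_pow_eq_0:
  assumes "0 < K" "K \<le> y" "0 \<le> a"
  shows "trunc_pow a K y = 0"
  using powr_mono2'[of "- a" K y] assms by (simp add: trunc_pow_def max_absorb1)

lemma trunc_pow_slope_pos:
  assumes "0 < y" "y < K" "0 < a"
  shows "0 < trunc_pow_slope a K y"
  using assms by (simp add: trunc_pow_slope_def powr_less_mono2_neg)

lemma trunc_pow_le_slope:
  assumes "0 < y" "0 < K" "0 < a"
  shows "2 * a * trunc_pow a K y \<le> K * trunc_pow_slope a K y"
proof (cases "y \<le> K")
  case True
  have "2 * a * trunc_pow a K y \<le> y * trunc_pow_slope a K y"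
    using trunc_pow_slope_ge[of y a K] assms by (simp add: field_simps)
  also have "\<dots> \<le> K * trunc_pow_slope a K y"
    using True assms by (intro mult_right_mono trunc_pow_slope_nonneg) auto
  finally show ?thesis .
next
  case False
  then show ?thesis
    using assms by (simp add: trunc_pow_eq_0 trunc_pow_slope_nonneg)
qed

section \<open>Gradients, fluxes and integrability\<close>

text \<open>Since \<open>grad\<close> is built from partial derivatives, linearity of the total derivative is needed to
  recover it from them.\<close>

lemma has_derivative_grad:
  fixes u :: "real ^ 'n \<Rightarrow> real"
  assumes "u differentiable (at x)"
  shows "(u has_derivative (\<lambda>v. grad u x \<bullet> v)) (at x)"
proof -
  let ?D = "frechet_derivative u (at x)"
  have D: "(u has_derivative ?D) (at x)"
    using assms by (simp add: frechet_derivative_works)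
  then interpret bounded_linear ?D
    by (rule has_derivative_bounded_linear)
  have "?D v = grad u x \<bullet> v" for v
  proof -
    have "?D v = ?D (\<Sum>i\<in>UNIV. v $ i *\<^sub>R axis i 1)"
      using basis_expansion[of v] by (simp add: scalar_mult_eq_scaleR)
    also have "\<dots> = (\<Sum>i\<in>UNIV. v $ i * ?D (axis i 1))"
      by (simp add: sum scale)
    finally show ?thesis
      by (simp add: grad_def inner_vec_def mult.commute)
  qed
  then have "?D = (\<lambda>v. grad u x \<bullet> v)"
    by blast
  with D show ?thesis
    by simp
qed

lemma grad_eqI:
  fixes u :: "real ^ 'n \<Rightarrow> real"
  assumes "(u has_derivative (\<lambda>v. g \<bullet> v)) (at x)"
  shows "grad u x = g"
  unfolding grad_def frechet_derivative_at[OF assms, symmetric]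
  by (simp add: vec_eq_iff inner_axis)

lemma norm_flux:
  assumes "1 < r"
  shows "norm (flux r \<xi>) = norm \<xi> powr (r - 1)"
proof (cases "\<xi> = 0")
  case False
  have "norm \<xi> powr (r - 2) * norm \<xi> = norm \<xi> powr (r - 2 + 1)"
    using False by (simp only: powr_add) simp
  then show ?thesis
    by (simp add: flux_def)
qed (use assms in \<open>simp add: flux_def\<close>)

lemma flux_inner_self:
  assumes "1 < r"
  shows "flux r \<xi> \<bullet> \<xi> = norm \<xi> powr r"
proof (cases "\<xi> = 0")
  case False
  have "norm \<xi> powr (r - 2) * (\<xi> \<bullet> \<xi>) = norm \<xi> powr (r - 2 + 2)"
    unfolding powr_add by (simp add: dot_square_norm)
  then show ?thesis
    by (simp add: flux_def)
qed (simp add: flux_def)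

text \<open>At the origin, where for \<open>r < 2\<close> the factor \<open>|\<xi>|^(r-2)\<close> is singular, continuity follows from
  \<open>|flux r \<xi>| = |\<xi>|^(r-1)\<close> and \<open>r > 1\<close>.\<close>

lemma continuous_on_flux:
  assumes "1 < r"
  shows "continuous_on UNIV (flux r)"
proof -
  have "isCont (flux r) \<xi>" for \<xi> :: "real ^ 'n"
  proof (cases "\<xi> = 0")
    case True
    have "((\<lambda>\<zeta>. norm (\<zeta> :: real ^ 'n) powr (r - 1)) \<longlongrightarrow> norm (0 :: real ^ 'n) powr (r - 1)) (at 0)"
      using assms by (intro tendsto_powr' tendsto_intros) auto
    then have "((\<lambda>\<zeta> :: real ^ 'n. norm (flux r \<zeta>)) \<longlongrightarrow> 0) (at 0)"
      using assms by (simp add: norm_flux)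
    then show ?thesis
      using True by (simp add: isCont_def tendsto_norm_zero_iff flux_def[of r 0])
  next
    case False
    then have "((\<lambda>\<zeta>. norm \<zeta> powr (r - 2) *\<^sub>R \<zeta>) \<longlongrightarrow> norm \<xi> powr (r - 2) *\<^sub>R \<xi>) (at \<xi>)"
      by (intro tendsto_intros) auto
    then show ?thesis
      by (simp add: isCont_def flux_def[abs_def])
  qed
  then show ?thesis
    by (intro continuous_at_imp_continuous_on ballI)
qed

lemma continuous_on_norm_pow:
  assumes "0 \<le> m"
  shows "continuous_on UNIV (\<lambda>\<xi> :: real ^ 'n. norm_pow \<xi> m)"
proof (cases "m = 0")
  case False
  then have "continuous_on UNIV (\<lambda>\<xi> :: real ^ 'n. norm \<xi> powr m)"
    using assms by (intro continuous_on_powr' continuous_on_norm continuous_on_id continuous_on_const) auto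
  with False show ?thesis
    by (simp add: norm_pow_def)
qed (simp add: norm_pow_def)

lemma integrable_lborel_compact_support:
  fixes f :: "'a::euclidean_space \<Rightarrow> real"
  assumes "continuous_on UNIV f" "compact S" "\<And>x. x \<notin> S \<Longrightarrow> f x = 0"
  shows "integrable lborel f"
proof -
  have "integrable lborel (\<lambda>x. indicator S x *\<^sub>R f x)"
    using assms continuous_on_subset by (intro borel_integrable_compact) blast+
  moreover have "(\<lambda>x. indicator S x *\<^sub>R f x) = f"
    using assms(3) by (auto simp: indicator_def fun_eq_iff)
  ultimately show ?thesis
    by simp
qed

section \<open>The test function\<close>

text \<open>In place of the value \<open>1\<close> on a smaller ball, this cutoff has a positive lower bound there, see
  \<open>bump_ge\<close>. A power of an explicit function has the advantage that its gradient is controlled by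
  the next smaller power.\<close>

definition bump :: "nat \<Rightarrow> real \<Rightarrow> real ^ 'n \<Rightarrow> real" where
  "bump k R x = (max 0 (1 - (norm x / R)\<^sup>2)) ^ k"

definition bump_grad :: "nat \<Rightarrow> real \<Rightarrow> real ^ 'n \<Rightarrow> real ^ 'n" where
  "bump_grad k R x = (- (2 * real k / R\<^sup>2) * (max 0 (1 - (norm x / R)\<^sup>2)) ^ (k - 1)) *\<^sub>R x"

lemma has_derivative_bump:
  fixes x :: "real ^ 'n"
  assumes "2 \<le> k"
  shows "(bump k R has_derivative (\<lambda>v. bump_grad k R x \<bullet> v)) (at x)"
proof -
  have eq: "(\<lambda>x :: real ^ 'n. 1 - (norm x / R)\<^sup>2) = (\<lambda>x. 1 - (x \<bullet> x) / R\<^sup>2)"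
    by (simp add: power_divide power2_norm_eq_inner)
  have "((\<lambda>x :: real ^ 'n. 1 - (norm x / R)\<^sup>2) has_derivative (\<lambda>v. - (2 * (x \<bullet> v)) / R\<^sup>2)) (at x)"
    unfolding eq divide_inverse
    by (auto intro!: derivative_eq_intros simp: inner_commute power_inverse algebra_simps)
  from DERIV_compose_FDERIV[OF DERIV_positive_part_power[OF assms] this]
  show ?thesis
    by (simp add: bump_def[abs_def] bump_grad_def algebra_simps)
qed


lemma C1I:
  fixes f :: "real ^ 'n \<Rightarrow> real"
  assumes "\<And>x. (f has_derivative (\<lambda>v. g x \<bullet> v)) (at x)" "continuous_on UNIV g"
  shows "C1 f" "grad f = g"
proof -
  show "grad f = g"
    using grad_eqI[OF assms(1)] by blast
  then show "C1 f"
    using assms by (auto simp: C1_def differentiable_def)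
qed

lemma bump_nonneg: "0 \<le> bump k R x"
  by (simp add: bump_def)

lemma bump_eq_0:
  fixes x :: "real ^ 'n"
  assumes "2 \<le> k" "0 < R" "x \<notin> cball 0 R"
  shows "bump k R x = 0" "bump_grad k R x = 0"
proof -
  have "1 \<le> norm x / R"
    using assms by simp
  then have "1 \<le> (norm x / R)\<^sup>2"
    by (metis one_power2 power_mono zero_le_one)
  then have "max 0 (1 - (norm x / R)\<^sup>2) = 0"
    by simp
  then show "bump k R x = 0" "bump_grad k R x = 0"
    using assms by (simp_all add: bump_def bump_grad_def power_0_left)
qed

lemma norm_bump_grad_le:
  fixes x :: "real ^ 'n"
  assumes "0 < R" "x \<in> cball 0 R"
  shows "norm (bump_grad k R x) \<le> 2 * real k / R * (max 0 (1 - (norm x / R)\<^sup>2)) ^ (k - 1)"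
proof -
  have "norm (bump_grad k R x)
      = 2 * real k / R * (max 0 (1 - (norm x / R)\<^sup>2)) ^ (k - 1) * (norm x / R)"
    using assms by (simp add: bump_grad_def abs_mult power2_eq_square)
  also have "\<dots> \<le> 2 * real k / R * (max 0 (1 - (norm x / R)\<^sup>2)) ^ (k - 1) * 1"
    using assms by (intro mult_left_mono) auto
  finally show ?thesis
    by simp
qed

lemma continuous_on_bump: "continuous_on UNIV (bump k R)"
  by (simp add: bump_def[abs_def] divide_inverse) (intro continuous_intros)

lemma continuous_on_bump_grad: "continuous_on UNIV (bump_grad k R)"
  by (simp add: bump_grad_def[abs_def] divide_inverse) (intro continuous_intros)

text \<open>Integrability is needed to combine the three integrals of the weak inequality into one, to which
  the pointwise estimate then applies.\<close>

lemma integrable_weak_form: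
  fixes u :: "real ^ 'n \<Rightarrow> real"
  assumes u: "C1 u" "\<And>x. 0 < u x" and \<phi>: "C1 \<phi>" and "1 < r" "0 \<le> s" "0 \<le> m"
    and S: "compact S" "\<And>x. x \<notin> S \<Longrightarrow> \<phi> x = 0" "\<And>x. x \<notin> S \<Longrightarrow> grad \<phi> x = 0"
  shows "integrable lborel (\<lambda>x. flux r (grad u x) \<bullet> grad \<phi> x)"
    and "integrable lborel (\<lambda>x. u x powr s * norm_pow (grad u x) m * \<phi> x)"
proof -
  have u_cont: "continuous_on UNIV u" and \<phi>_cont: "continuous_on UNIV \<phi>"
    using u \<phi> by (auto simp: C1_def continuous_on_eq_continuous_at
        intro: differentiable_imp_continuous_within)
  have g: "continuous_on UNIV (grad u)" "continuous_on UNIV (grad \<phi>)"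
    using u \<phi> by (auto simp: C1_def)
  have f: "continuous_on UNIV (\<lambda>x. flux r (grad u x))"
    using continuous_on_compose2[OF continuous_on_flux[OF \<open>1 < r\<close>] g(1)] by simp
  have n: "continuous_on UNIV (\<lambda>x. norm_pow (grad u x) m)"
    using continuous_on_compose2[OF continuous_on_norm_pow[OF \<open>0 \<le> m\<close>] g(1)] by simp
  have p: "continuous_on UNIV (\<lambda>x. u x powr s)"
    using u_cont u(2) by (intro continuous_on_powr continuous_on_const) (auto simp: less_imp_neq[OF u(2), symmetric])
  show "integrable lborel (\<lambda>x. flux r (grad u x) \<bullet> grad \<phi> x)"
    by (rule integrable_lborel_compact_support[OF continuous_on_inner[OF f g(2)] S(1)])
      (simp add: S)
  show "integrable lborel (\<lambda>x. u x powr s * norm_pow (grad u x) m * \<phi> x)"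
    by (rule integrable_lborel_compact_support[OF
          continuous_on_mult[OF continuous_on_mult[OF p n] \<phi>_cont] S(1)]) (simp add: S)
qed

definition test_fun :: "real \<Rightarrow> real \<Rightarrow> nat \<Rightarrow> real \<Rightarrow> (real ^ 'n \<Rightarrow> real) \<Rightarrow> real ^ 'n \<Rightarrow> real" where
  "test_fun a K k R u x = trunc_pow a K (u x) * bump k R x"

lemma test_fun_C1:
  fixes u :: "real ^ 'n \<Rightarrow> real"
  assumes u: "C1 u" "\<And>x. 0 < u x" and "2 \<le> k"
  shows "C1 (test_fun a K k R u)"
    and "grad (test_fun a K k R u) = (\<lambda>x. trunc_pow a K (u x) *\<^sub>R bump_grad k R x
      - (trunc_pow_slope a K (u x) * bump k R x) *\<^sub>R grad u x)"
      (is "_ = ?G")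
proof -
  have u_cont: "continuous_on UNIV u" and g: "continuous_on UNIV (grad u)"
    using u by (auto simp: C1_def continuous_on_eq_continuous_at
        intro: differentiable_imp_continuous_within)
  have "(test_fun a K k R u has_derivative (\<lambda>v. ?G x \<bullet> v)) (at x)" for x
  proof -
    have "(u has_derivative (\<lambda>v. grad u x \<bullet> v)) (at x)"
      using u by (intro has_derivative_grad) (auto simp: C1_def)
    from DERIV_compose_FDERIV[OF DERIV_trunc_pow[OF u(2)] this]
    have "((\<lambda>x. trunc_pow a K (u x)) has_derivative
        (\<lambda>v. (grad u x \<bullet> v) * - trunc_pow_slope a K (u x))) (at x)" .
    from has_derivative_mult[OF this has_derivative_bump[OF \<open>2 \<le> k\<close>, of R x]] show ?thesis
      by (simp add: test_fun_def[abs_def] inner_diff_left algebra_simps)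
  qed
  moreover have "continuous_on UNIV ?G"
    unfolding trunc_pow_def trunc_pow_slope_def using u(2)
    by (intro continuous_intros u_cont g continuous_on_bump continuous_on_bump_grad)
      (auto simp: less_imp_neq[OF u(2), symmetric])
  ultimately show "C1 (test_fun a K k R u)" "grad (test_fun a K k R u) = ?G"
    by (rule C1I)+
qed

lemma test_fun_compact_support:
  fixes u :: "real ^ 'n \<Rightarrow> real"
  assumes u: "C1 u" "\<And>x. 0 < u x" and "2 \<le> k" "0 < R"
  shows "C1_compact_support (test_fun a K k R u)"
proof -
  have "{x. test_fun a K k R u x \<noteq> 0} \<subseteq> cball 0 R"
  proof
    fix x
    assume "x \<in> {x. test_fun a K k R u x \<noteq> 0}"
    then have "bump k R x \<noteq> 0"
      by (auto simp: test_fun_def)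
    then show "x \<in> cball 0 R"
      using bump_eq_0(1)[OF \<open>2 \<le> k\<close> \<open>0 < R\<close>, of x] by blast
  qed
  then have "compact (closure {x. test_fun a K k R u x \<noteq> 0})"
    using bounded_cball bounded_subset compact_closure by blast
  then show ?thesis
    using test_fun_C1[OF assms(1-3)] by (simp add: C1_compact_support_def)
qed


section \<open>The pointwise estimate and the Liouville theorem\<close>

text \<open>The gradient terms produced by the cutoff are absorbed at each single point, up to a constant
  of order \<open>R^(-1/c)\<close>. Half of the \<open>q\<close>-energy survives, and this is what the theorem exploits.\<close>

lemma test_fun_pointwise:
  fixes u :: "real ^ 'n \<Rightarrow> real"
  assumes u: "C1 u" "\<And>x. 0 < u x" and pq: "1 < q" "q < p" and "0 \<le> m"
    and abc: "0 < a" "0 < b" "0 < c" "a + b + c = 1" "q * a + m * b = q - 1"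
      "a = b * s + \<alpha> * c" "0 < \<alpha>"
    and k: "2 \<le> k" "1 + p - q \<le> real k * c"
    and K: "0 < K" and R: "0 < R" "2 * real k / R * K \<le> \<alpha>" and x: "x \<in> cball 0 R"
  defines "\<psi> \<equiv> test_fun (\<alpha> / 2) K k R u"
  shows "flux p (grad u x) \<bullet> grad \<psi> x + flux q (grad u x) \<bullet> grad \<psi> x
      - u x powr s * norm_pow (grad u x) m * \<psi> x
    \<le> ((\<alpha> / 2) powr - a * (4 * real k / R)) powr (1 / c)
      - trunc_pow_slope (\<alpha> / 2) K (u x) * norm (grad u x) powr q / 2 * bump k R x"
proof -
  define h H where "h = trunc_pow (\<alpha> / 2) K (u x)" and "H = trunc_pow_slope (\<alpha> / 2) K (u x)"
  define t T y where "t = norm (grad u x)" and "T = norm_pow (grad u x) m" and "y = u x"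
  define \<rho> where "\<rho> = max 0 (1 - (norm x / R)\<^sup>2)"
  define \<Phi> where "\<Phi> = \<rho> ^ k"
  define l where "l = 2 * real k / R"
  define S where "S = t powr (q - 1) * \<Phi> powr (1 - c)"
  define Z where "Z = ((\<alpha> / 2) powr - a * (2 * l)) powr (1 / c)"
  have \<rho>: "0 \<le> \<rho>" "\<rho> \<le> 1"
    by (auto simp: \<rho>_def)
  have \<Phi>: "0 \<le> \<Phi>" "bump k R x = \<Phi>"
    using \<rho> by (auto simp: \<Phi>_def bump_def \<rho>_def)
  have y: "0 < y" and t: "0 \<le> t" and h: "0 \<le> h" and H: "0 \<le> H" and l: "0 < l" and T: "0 \<le> T"
    using u abc R k
    by (auto simp: y_def t_def h_def H_def l_def T_def trunc_pow_nonneg trunc_pow_slope_nonneg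
        norm_pow_def)
  have S: "0 \<le> S"
    by (simp add: S_def)
  have flux_le: "flux r (grad u x) \<bullet> grad \<psi> x \<le> h * l * (t powr (r - 1) * \<rho> ^ (k - 1)) - H * \<Phi> * t powr r"
    if "1 < r" for r
  proof -
    have "flux r (grad u x) \<bullet> grad \<psi> x
        = h * (flux r (grad u x) \<bullet> bump_grad k R x) - H * \<Phi> * t powr r"
      using that unfolding \<psi>_def test_fun_C1(2)[OF u \<open>2 \<le> k\<close>]
      by (simp add: inner_diff_right flux_inner_self h_def H_def \<Phi> t_def)
    moreover have "flux r (grad u x) \<bullet> bump_grad k R x \<le> t powr (r - 1) * (l * \<rho> ^ (k - 1))"
    proof -
      have "flux r (grad u x) \<bullet> bump_grad k R x \<le> norm (flux r (grad u x)) * norm (bump_grad k R x)"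
        by (rule norm_cauchy_schwarz)
      also have "\<dots> \<le> t powr (r - 1) * (l * \<rho> ^ (k - 1))"
        using norm_bump_grad_le[OF R(1) x, of k]
        by (intro mult_mono) (auto simp: norm_flux[OF that] t_def l_def \<rho>_def)
      finally show ?thesis .
    qed
    then have "h * (flux r (grad u x) \<bullet> bump_grad k R x) \<le> h * (t powr (r - 1) * (l * \<rho> ^ (k - 1)))"
      using h by (rule mult_left_mono)
    ultimately show ?thesis
      by (simp add: algebra_simps)
  qed
  have "flux p (grad u x) \<bullet> grad \<psi> x + flux q (grad u x) \<bullet> grad \<psi> x
      \<le> h * l * ((t powr (p - 1) + t powr (q - 1)) * \<rho> ^ (k - 1)) - H * \<Phi> * (t powr p + t powr q)"
    using flux_le[of p] flux_le[of q] pq by (simp add: algebra_simps)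
  also have "\<dots> \<le> h * l * (t powr p * \<Phi> + 2 * S) - H * \<Phi> * (t powr p + t powr q)"
    unfolding S_def \<Phi>_def using h l t \<rho> pq abc k
    by (intro diff_right_mono mult_left_mono higher_power_absorption) auto
  finally have 1: "flux p (grad u x) \<bullet> grad \<psi> x + flux q (grad u x) \<bullet> grad \<psi> x
      \<le> h * l * (t powr p * \<Phi>) + h * (2 * l * S) - H * (t powr p * \<Phi>) - H * (t powr q * \<Phi>)"
    by (simp add: algebra_simps)
  \<comment> \<open>For large \<open>R\<close> the \<open>p\<close>-energy alone absorbs the term with \<open>t^p\<close>.\<close>
  have "\<alpha> * h \<le> K * H"
    using trunc_pow_le_slope[of "u x" K "\<alpha> / 2"] u K abc by (simp add: h_def H_def)
  moreover have "l * K * h \<le> \<alpha> * h"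
    using R h by (intro mult_right_mono) (auto simp: l_def)
  ultimately have "K * (h * l) \<le> K * H"
    by (simp add: algebra_simps)
  then have "h * l \<le> H"
    using K by simp
  then have 2: "h * l * (t powr p * \<Phi>) \<le> H * (t powr p * \<Phi>)"
    using \<Phi> by (intro mult_right_mono) auto
  \<comment> \<open>With \<open>\<epsilon> = \<alpha>/2\<close> the first term of the interpolation costs half of the \<open>q\<close>-energy, and the
    second one is cancelled by the source term.\<close>
  have "2 * l * S \<le> \<alpha> / 2 * (t powr q * \<Phi> / y) + y powr s * T * \<Phi> + Z * y powr \<alpha>"
    unfolding S_def Z_def
    using abc t y \<Phi> l T pq
    by (intro gradient_term_interpolation[where b = b and m = m]) (auto simp: T_def t_def norm_pow_def)
  then have "h * (2 * l * S) \<le> h * (\<alpha> / 2 * (t powr q * \<Phi> / y) + y powr s * T * \<Phi> + Z * y powr \<alpha>)"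
    using h by (rule mult_left_mono)
  then have 3: "h * (2 * l * S)
      \<le> \<alpha> * h / y * (t powr q * \<Phi>) / 2 + y powr s * T * (h * \<Phi>) + Z * (h * y powr \<alpha>)"
    by (simp add: algebra_simps)
  define V U where "V = \<alpha> * h / y * (t powr q * \<Phi>)" and "U = y powr s * T * (h * \<Phi>)"
  have "\<alpha> * h / y \<le> H"
    using trunc_pow_slope_ge[of "u x" "\<alpha> / 2" K] u abc by (simp add: h_def H_def y_def)
  then have 4: "V \<le> H * (t powr q * \<Phi>)"
    unfolding V_def using \<Phi> by (intro mult_right_mono) auto
  have "Z * (h * y powr \<alpha>) \<le> Z * 1"
    using trunc_pow_le[of "u x" "\<alpha> / 2" K] u by (intro mult_left_mono) (auto simp: h_def y_def Z_def)
  with 1 2 3[folded V_def U_def] 4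
  have "flux p (grad u x) \<bullet> grad \<psi> x + flux q (grad u x) \<bullet> grad \<psi> x - U \<le> Z - H * (t powr q * \<Phi>) / 2"
    by linarith
  moreover have "\<psi> x = h * \<Phi>"
    by (simp add: \<psi>_def test_fun_def h_def \<Phi>)
  ultimately show ?thesis
    by (simp add: U_def y_def T_def Z_def l_def H_def t_def \<Phi> algebra_simps)
qed

lemma bump_ge:
  fixes x :: "real ^ 'n"
  assumes "0 < R" "norm x \<le> R / 2"
  shows "(3 / 4) ^ k \<le> bump k R x"
proof -
  have "(norm x / R)\<^sup>2 \<le> (1 / 2)\<^sup>2"
    using assms by (intro power_mono) (auto simp: field_simps)
  also have "(1 / 2 :: real)\<^sup>2 = 1 / 4"
    by (simp add: power2_eq_square)
  finally have "3 / 4 \<le> 1 - (norm x / R)\<^sup>2"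
    by linarith
  then have "3 / 4 \<le> max 0 (1 - (norm x / R)\<^sup>2)"
    by (rule max.coboundedI2)
  then show ?thesis
    unfolding bump_def by (rule power_mono) simp
qed

theorem theorem1p9:
  fixes u :: "real ^ 'n \<Rightarrow> real" and p q s m :: real
  assumes "1 < q" and "q < p" and "q < real CARD('n)"
    and "0 \<le> s" and "0 \<le> m" and "m \<le> q - 1"
    and "s * (real CARD('n) - q) + m * (real CARD('n) - 1) < real CARD('n) * (q - 1)"
    and "positive_solution p q s m u"
  shows "u constant_on UNIV"
proof -
  let ?N = "real CARD('n)"
  have u: "C1 u" "\<And>x. 0 < u x"
    and weak: "\<And>\<phi>. C1_compact_support \<phi> \<Longrightarrow> (\<forall>x. 0 \<le> \<phi> x) \<Longrightarrow>
      (LINT x|lborel. u x powr s * norm_pow (grad u x) m * \<phi> x)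
      \<le> (LINT x|lborel. flux p (grad u x) \<bullet> grad \<phi> x) + (LINT x|lborel. flux q (grad u x) \<bullet> grad \<phi> x)"
    using assms(8) by (auto simp: positive_solution_def)
  have u_cont: "continuous_on UNIV u" and g: "continuous_on UNIV (grad u)"
    using u by (auto simp: C1_def continuous_on_eq_continuous_at
        intro: differentiable_imp_continuous_within)
  obtain a b c \<alpha> where abc: "0 < a" "0 < b" "0 < c" "a + b + c = 1" "q * a + m * b = q - 1"
      "a = b * s + \<alpha> * c" "0 < \<alpha>" and cN: "c * ?N < 1"
    using exponent_choice[OF assms(1,3-7)] by metis
  define k where "k = nat \<lceil>(1 + p - q) / c\<rceil> + 2"
  have "(1 + p - q) / c \<le> real k"
    unfolding k_def by linarith
  then have k: "2 \<le> k" "1 + p - q \<le> real k * c"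
    using abc by (auto simp: k_def field_simps)
  have grad0: "grad u x0 = 0" for x0
  proof (rule ccontr)
    assume nz: "grad u x0 \<noteq> 0"
    \<comment> \<open>any level above \<open>u x0\<close> will do: it makes the \<open>q\<close>-energy density \<open>f\<close> positive at \<open>x0\<close>\<close>
    define K where "K = u x0 + 1"
    have K: "0 < K"
      using u(2)[of x0] by (simp add: K_def)
    define f where "f x = trunc_pow_slope (\<alpha> / 2) K (u x) * norm (grad u x) powr q / 2" for x
    have f0: "0 < f x0"
      using nz abc u by (auto simp: f_def K_def intro!: mult_pos_pos trunc_pow_slope_pos)
    have f_nonneg: "0 \<le> f x" for x
      using abc by (simp add: f_def trunc_pow_slope_nonneg)
    have "continuous_on UNIV f"
    proof -
      have "continuous_on UNIV (\<lambda>x. norm (grad u x) powr q)"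
        using assms(1) by (intro continuous_on_powr' continuous_on_norm g continuous_on_const) auto
      then show ?thesis
        unfolding f_def trunc_pow_slope_def
        by (intro continuous_on_divide continuous_on_mult continuous_on_max continuous_on_diff
            continuous_on_const)
          (auto intro!: continuous_on_powr u_cont simp: less_imp_neq[OF u(2), symmetric])
    qed
    then have "\<forall>\<^sub>F x in nhds x0. f x0 / 2 < f x"
      using f0 by (intro order_tendstoD(1)[of f "f x0"])
        (auto simp: continuous_on_eq_continuous_at isCont_def tendsto_at_iff_tendsto_nhds)
    then obtain r where r: "0 < r" "\<And>x. dist x x0 < r \<Longrightarrow> f x0 / 2 < f x"
      unfolding eventually_nhds_metric by blast
    define \<delta> where "\<delta> = f x0 / 2 * (3 / 4) ^ k"
    have \<delta>: "0 < \<delta>"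
      using f0 by (simp add: \<delta>_def)
    define Z where "Z R = ((\<alpha> / 2) powr - a * (4 * real k / R)) powr (1 / c)" for R :: real
    have bound: "\<delta> * measure lborel (ball x0 r) \<le> Z R * measure lborel (cball (0 :: real ^ 'n) R)"
      if R: "0 < R" "2 * real k * K / \<alpha> \<le> R" "2 * (norm x0 + r) \<le> R" for R
    proof -
      define \<psi> where "\<psi> = test_fun (\<alpha> / 2) K k R u"
      let ?P = "\<lambda>x. flux p (grad u x) \<bullet> grad \<psi> x" and ?Q = "\<lambda>x. flux q (grad u x) \<bullet> grad \<psi> x"
        and ?W = "\<lambda>x. u x powr s * norm_pow (grad u x) m * \<psi> x"
      have R': "2 * real k / R * K \<le> \<alpha>"
        using R abc by (simp add: field_simps)
      have C1\<psi>: "C1 \<psi>"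
        unfolding \<psi>_def using u k by (intro test_fun_C1) auto
      have out: "\<psi> x = 0" "grad \<psi> x = 0" if "x \<notin> cball 0 R" for x
        using bump_eq_0[OF k(1) R(1) that]
        by (auto simp: \<psi>_def test_fun_C1(2)[OF u k(1)] test_fun_def)
      have iP: "integrable lborel ?P" and iQ: "integrable lborel ?Q" and iW: "integrable lborel ?W"
        using integrable_weak_form[OF u C1\<psi> _ assms(4,5) compact_cball out] assms(1,2)
        by (meson less_trans)+
      have i0: "integrable lborel (indicator (ball x0 r) :: _ \<Rightarrow> real)"
        and i1: "integrable lborel (indicator (cball 0 R) :: real ^ 'n \<Rightarrow> real)"
        by (intro integrable_real_indicator emeasure_lborel_ball_finite emeasure_lborel_cball_finite;
            simp)+
      have le: "?P x + ?Q x - ?W x \<le> Z R * indicator (cball 0 R) x - \<delta> * indicator (ball x0 r) x" for x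
      proof (cases "x \<in> cball 0 R")
        case True
        have "?P x + ?Q x - ?W x \<le> Z R - f x * bump k R x"
          unfolding \<psi>_def Z_def f_def
          using test_fun_pointwise[OF u assms(1,2,5) abc k K R(1) R' True] .
        moreover have "\<delta> * indicator (ball x0 r) x \<le> f x * bump k R x"
        proof (cases "x \<in> ball x0 r")
          case True
          then have "norm x \<le> norm x0 + r"
            using norm_triangle_ineq2[of x x0] by (simp add: dist_norm norm_minus_commute)
          then have "(3 / 4) ^ k \<le> bump k R x"
            using R by (intro bump_ge) auto
          then have "f x0 / 2 * (3 / 4) ^ k \<le> f x * bump k R x"
            using r(2)[of x] True f0 by (intro mult_mono) (auto simp: dist_commute)
          then show ?thesis
            using True by (simp add: \<delta>_def)
        qed (simp add: f_nonneg bump_nonneg)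
        ultimately show ?thesis
          using True by simp
      next
        case False
        have "norm x0 + r \<le> 2 * (norm x0 + r)"
          using r(1) by simp
        then have "norm x0 + r \<le> R"
          using R(3) by (rule order_trans)
        then have "x \<notin> ball x0 r"
          using False norm_triangle_ineq2[of x x0] by (auto simp: dist_norm norm_minus_commute)
        then show ?thesis
          using False by (simp add: out)
      qed
      have "0 \<le> (LINT x|lborel. ?P x + ?Q x - ?W x)"
        using weak[of \<psi>] test_fun_compact_support[OF u k(1) R(1)] iP iQ iW
        by (simp add: \<psi>_def test_fun_def trunc_pow_nonneg bump_nonneg)
      also have "\<dots> \<le> (LINT x|lborel. Z R * indicator (cball 0 R) x - \<delta> * indicator (ball x0 r) x)"
        using iP iQ iW i0 i1
        by (intro integral_mono le Bochner_Integration.integrable_diff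
            Bochner_Integration.integrable_add integrable_mult_right)
      also have "\<dots> = Z R * measure lborel (cball (0 :: real ^ 'n) R) - \<delta> * measure lborel (ball x0 r)"
        using i0 i1 by simp
      finally show ?thesis
        by simp
    qed
    \<comment> \<open>The left-hand side of the bound does not depend on \<open>R\<close>, and \<open>1 / c > N\<close>.\<close>
    define C where "C = ((\<alpha> / 2) powr - a * (4 * real k)) powr (1 / c) * unit_ball_vol ?N"
    have bound': "\<delta> * measure lborel (ball x0 r) \<le> C * R powr (?N - 1 / c)"
      if R: "0 < R" "2 * real k * K / \<alpha> \<le> R" "2 * (norm x0 + r) \<le> R" for R
    proof -
      have "Z R = (((\<alpha> / 2) powr - a * (4 * real k)) / R) powr (1 / c)"
        by (simp add: Z_def)
      also have "\<dots> = ((\<alpha> / 2) powr - a * (4 * real k)) powr (1 / c) * R powr - (1 / c)"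
        using R(1) by (subst powr_divide) (simp_all add: powr_minus_divide)
      finally have Z: "Z R = \<dots>" .
      have "measure lborel (cball (0 :: real ^ 'n) R) = unit_ball_vol ?N * R powr ?N"
        using R(1) by (simp add: content_cball powr_realpow)
      then have "Z R * measure lborel (cball (0 :: real ^ 'n) R) = C * (R powr - (1 / c) * R powr ?N)"
        unfolding Z C_def by (simp only: ac_simps)
      also have "R powr - (1 / c) * R powr ?N = R powr (?N - 1 / c)"
        unfolding powr_add[symmetric] by simp
      finally show ?thesis
        using bound[OF R] by (simp only:)
    qed
    have "?N - 1 / c < 0"
      using cN abc(3) by (simp add: field_simps)
    then have "((\<lambda>R. C * R powr (?N - 1 / c)) \<longlongrightarrow> C * 0) at_top"
      by (intro tendsto_mult tendsto_const tendsto_neg_powr filterlim_ident)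
    moreover have "\<forall>\<^sub>F R in at_top. \<delta> * measure lborel (ball x0 r) \<le> C * R powr (?N - 1 / c)"
      using eventually_gt_at_top[of 0] eventually_ge_at_top[of "2 * real k * K / \<alpha>"]
        eventually_ge_at_top[of "2 * (norm x0 + r)"]
      by eventually_elim (rule bound')
    ultimately have "\<delta> * measure lborel (ball x0 r) \<le> C * 0"
      by (rule tendsto_lowerbound) simp
    moreover have "0 < measure lborel (ball x0 r)"
      using r(1) by (rule content_ball_pos)
    ultimately show False
      using \<delta> by (simp add: mult_le_0_iff)
  qed
  have "(u has_derivative (\<lambda>v. 0)) (at x)" for x
    using has_derivative_grad[of u x] u grad0[of x] by (simp add: C1_def)
  then have "\<exists>d. \<forall>x\<in>UNIV. u x = d"
    using has_derivative_zero_constant[of UNIV u] by auto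
  then show ?thesis
    by (auto simp: constant_on_def)
qed

end
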